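(* $\mathrm{BWT}_2'\not\leq_W\mathrm{RT}_{1,2}'$.
   Context: Weihrauch framework. A represented space is a set $X$ with a surjective partial map $\delta_X:\subseteq\mathbb{N}^{\mathbb{N}}\to X$. A problem is a partial multi-valued function $f:\subseteq X\rightrightarrows Y$; a partial $F:\subseteq\mathbb{N}^{\mathbb{N}}\to\mathbb{N}^{\mathbb{N}}$ realizes $f$ if $\delta_Y(F(p))\in f(\delta_X(p))$ whenever $\delta_X(p)\in\mathrm{dom}(f)$. With $\langle\cdot,\cdot\rangle$ a standard computable pairing on Baire space, $f\leq_W g$ means there are computable partial $H,K$ on Baire space such that $p\mapsto H\langle p,G(K(p))\rangle$ realizes $f$ for every realizer $G$ of $g$. $\lim:\subseteq\mathbb{N}^{\mathbb{N}}\to\mathbb{N}^{\mathbb{N}}$ maps $\langle p_0,p_1,\dots\rangle$ (where $\langle p_0,p_1,\dots\rangle\langle i,j\rangle=p_i(j)$) to $\lim_i p_i$ if it exists. The jump $f'$ of $f$ is the same multi-valued map with input representation $\delta_X\circ\lim$. $\mathrm{BWT}_2:\{0,1\}^{\mathbb{N}}\rightrightarrows\{0,1\}$ maps a binary sequence to the set of values occurring infinitely often in it. $\mathrm{RT}_{1,2}$ maps a coloring $c:\mathbb{N}\to\{0,1\}$ (given as its sequence of values, identifying $[\mathbb{N}]^1$ with $\mathbb{N}$) to the set of characteristic functions of infinite sets $M\subseteq\mathbb{N}$ on which $c$ is constant. *)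

theory Defs
  imports "HOL-Analysis.Analysis" "HOL-Library.Nat_Bijection"
begin

type_synonym baire = "nat \<Rightarrow> nat"

section \<open>Computability on Baire space\<close>

text \<open>
  Programs for partial recursive functions relative to an oracle in Baire space. Arguments beyond
  those a program needs are ignored; a program that lacks an argument has no value. Neither
  convention changes the class of functions that can be computed.
\<close>

datatype oprog =
    Zero
  | Succ
  | Proj nat
  | Oracle
  | Comp oprog "oprog list"
  | PrimRec oprog oprog
  | Mu oprog

text \<open>\<open>ocomp p e xs y\<close>: with oracle \<open>p\<close>, program \<open>e\<close> halts on the arguments \<open>xs\<close> with value \<open>y\<close>.\<close>

inductive ocomp :: "baire \<Rightarrow> oprog \<Rightarrow> nat list \<Rightarrow> nat \<Rightarrow> bool" for p :: baire where
  Zero: "ocomp p Zero xs 0"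
| Succ: "ocomp p Succ (x # xs) (Suc x)"
| Proj: "i < length xs \<Longrightarrow> ocomp p (Proj i) xs (xs ! i)"
| Oracle: "ocomp p Oracle (x # xs) (p x)"
| Comp: "list_all2 (\<lambda>g y. ocomp p g xs y) gs ys \<Longrightarrow> ocomp p f ys z \<Longrightarrow> ocomp p (Comp f gs) xs z"
| PrimRec_0: "ocomp p f xs y \<Longrightarrow> ocomp p (PrimRec f g) (0 # xs) y"
| PrimRec_Suc: "ocomp p (PrimRec f g) (n # xs) r \<Longrightarrow> ocomp p g (n # r # xs) y \<Longrightarrow>
    ocomp p (PrimRec f g) (Suc n # xs) y"
| Mu: "(\<And>i. i < n \<Longrightarrow> \<exists>k. ocomp p f (i # xs) (Suc k)) \<Longrightarrow> ocomp p f (n # xs) 0 \<Longrightarrow>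
    ocomp p (Mu f) xs n"

inductive_cases ocomp_ZeroE: "ocomp p Zero xs y"
inductive_cases ocomp_SuccE: "ocomp p Succ xs y"
inductive_cases ocomp_ProjE: "ocomp p (Proj i) xs y"
inductive_cases ocomp_OracleE: "ocomp p Oracle xs y"
inductive_cases ocomp_CompE: "ocomp p (Comp f gs) xs y"
inductive_cases ocomp_PrimRec_0E: "ocomp p (PrimRec f g) (0 # xs) y"
inductive_cases ocomp_PrimRec_SucE: "ocomp p (PrimRec f g) (Suc n # xs) y"
inductive_cases ocomp_MuE: "ocomp p (Mu f) xs y"

lemma ocomp_deterministic: "ocomp p e xs y \<Longrightarrow> ocomp p e xs z \<Longrightarrow> z = y"
proof (induction arbitrary: z rule: ocomp.induct)
  case (Comp xs gs ys f y)
  from Comp.prems obtain ys' where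
    ys': "list_all2 (\<lambda>g y. ocomp p g xs y) gs ys'" "ocomp p f ys' z"
    by (rule ocomp_CompE)
  have "ys' = ys"
    using Comp.IH(1) ys'(1) by (auto simp: list_all2_conv_all_nth intro!: nth_equalityI)
  then show ?case using Comp.IH(2) ys'(2) by simp
next
  case (PrimRec_Suc f g n xs r y)
  from PrimRec_Suc.prems obtain r' where
    "ocomp p (PrimRec f g) (n # xs) r'" "ocomp p g (n # r' # xs) z"
    by (rule ocomp_PrimRec_SucE)
  then show ?case using PrimRec_Suc.IH by blast
next
  case (Mu n f xs)
  from Mu.prems have z: "\<And>i. i < z \<Longrightarrow> \<exists>k. ocomp p f (i # xs) (Suc k)" "ocomp p f (z # xs) 0"
    by (blast elim: ocomp_MuE)+
  show ?case
  proof (rule linorder_cases[of z n])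
    assume "z < n"
    then obtain k where "\<And>w. ocomp p f (z # xs) w \<Longrightarrow> w = Suc k" using Mu.IH(1) by blast
    then show ?thesis using z(2) by fastforce
  next
    assume "n < z"
    then obtain k where "ocomp p f (n # xs) (Suc k)" using z(1) by blast
    then show ?thesis using Mu.IH(2) by fastforce
  qed
qed (blast elim: ocomp_ZeroE ocomp_SuccE ocomp_ProjE ocomp_OracleE ocomp_PrimRec_0E)+

text \<open>
  A partial function on Baire space is computable if one program computes all its values on its
  domain. The program may also halt outside the domain, as usual for realizers.
\<close>

definition computable_baire :: "(baire \<rightharpoonup> baire) \<Rightarrow> bool" where
  "computable_baire F \<longleftrightarrow> (\<exists>e. \<forall>p q. F p = Some q \<longrightarrow> (\<forall>n. ocomp p e [n] (q n)))"

section \<open>Represented spaces, problems and Weihrauch reducibility\<close>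

text \<open>
  A represented space is given by its representation \<open>\<delta> :: baire \<rightharpoonup> 'a\<close>; the underlying set is
  \<open>ran \<delta>\<close>, so surjectivity is built in. A partial multi-valued function is a set-valued function
  \<open>sol\<close> whose domain consists of the points with nonempty value.
\<close>

record ('a, 'b) problem =
  in_rep :: "baire \<rightharpoonup> 'a"
  out_rep :: "baire \<rightharpoonup> 'b"
  sol :: "'a \<Rightarrow> 'b set"

definition prob_dom :: "('a, 'b) problem \<Rightarrow> 'a set" where
  "prob_dom f = {x. sol f x \<noteq> {}}"

definition well_formed_problem :: "('a, 'b) problem \<Rightarrow> bool" where
  "well_formed_problem f \<longleftrightarrow>
     prob_dom f \<subseteq> ran (in_rep f) \<and> (\<forall>x. sol f x \<subseteq> ran (out_rep f))"

definition realizes :: "(baire \<rightharpoonup> baire) \<Rightarrow> ('a, 'b) problem \<Rightarrow> bool" where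
  "realizes F f \<longleftrightarrow>
     (\<forall>p x. in_rep f p = Some x \<longrightarrow> x \<in> prob_dom f \<longrightarrow>
        (\<exists>q y. F p = Some q \<and> out_rep f q = Some y \<and> y \<in> sol f x))"

definition baire_pair :: "baire \<Rightarrow> baire \<Rightarrow> baire" where
  "baire_pair p q = (\<lambda>n. if even n then p (n div 2) else q (n div 2))"

definition weihrauch_le :: "('a, 'b) problem \<Rightarrow> ('c, 'd) problem \<Rightarrow> bool" (infix "\<le>\<^sub>W" 50) where
  "f \<le>\<^sub>W g \<longleftrightarrow>
     (\<exists>H K. computable_baire H \<and> computable_baire K \<and>
        (\<forall>G. realizes G g \<longrightarrow>
           realizes (\<lambda>p. case (G \<circ>\<^sub>m K) p of None \<Rightarrow> None | Some q \<Rightarrow> H (baire_pair p q)) f))"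

section \<open>Jumps\<close>

text \<open>
  The index pairing is Cantor's \<open>prod_encode\<close>, and limits are taken in the product topology of
  the discrete space \<open>nat\<close>.
\<close>

definition baire_section :: "baire \<Rightarrow> nat \<Rightarrow> baire" where
  "baire_section p i = (\<lambda>j. p (prod_encode (i, j)))"

definition baire_lim :: "baire \<rightharpoonup> baire" where
  "baire_lim p =
     (if convergent (baire_section p) then Some (THE q. baire_section p \<longlonglongrightarrow> q) else None)"

definition jump :: "('a, 'b) problem \<Rightarrow> ('a, 'b) problem" where
  "jump f = f\<lparr>in_rep := in_rep f \<circ>\<^sub>m baire_lim\<rparr>"

lemma LIMSEQ_baire_iff:
  fixes X :: "nat \<Rightarrow> baire"
  shows "X \<longlonglongrightarrow> q \<longleftrightarrow> (\<forall>j. \<forall>\<^sub>F i in sequentially. X i j = q j)"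
proof -
  have "X \<longlonglongrightarrow> q \<longleftrightarrow> limitin (product_topology (\<lambda>_. euclidean) UNIV) X q sequentially"
    by (metis euclidean_product_topology limitin_canonical_iff)
  also have "\<dots> \<longleftrightarrow> (\<forall>j. (\<lambda>i. X i j) \<longlonglongrightarrow> q j)"
    by (simp add: limitin_componentwise)
  finally show ?thesis by (simp add: tendsto_discrete)
qed

lemma LIMSEQ_baire_unique:
  fixes X :: "nat \<Rightarrow> baire"
  assumes "X \<longlonglongrightarrow> q" "X \<longlonglongrightarrow> r"
  shows "q = r"
proof
  fix j
  have "\<forall>\<^sub>F i in sequentially. X i j = q j \<and> X i j = r j"
    using assms by (simp add: LIMSEQ_baire_iff eventually_conj_iff)
  then have "\<exists>i. X i j = q j \<and> X i j = r j"
    by (auto simp: eventually_sequentially)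
  then show "q j = r j" by auto
qed

lemma baire_lim_eq_Some_iff:
  "baire_lim p = Some q \<longleftrightarrow> (\<forall>j. \<forall>\<^sub>F i in sequentially. p (prod_encode (i, j)) = q j)"
proof -
  have the: "(THE r. baire_section p \<longlonglongrightarrow> r) = q" if "baire_section p \<longlonglongrightarrow> q" for q
    using that LIMSEQ_baire_unique by blast
  have "baire_lim p = Some q \<longleftrightarrow> baire_section p \<longlonglongrightarrow> q"
  proof (cases "convergent (baire_section p)")
    case True
    then obtain r where r: "baire_section p \<longlonglongrightarrow> r" by (auto simp: convergent_def)
    have "baire_lim p = Some r" using True the[OF r] by (simp add: baire_lim_def)
    then show ?thesis using r LIMSEQ_baire_unique by auto
  next
    case False
    then show ?thesis by (auto simp: baire_lim_def convergent_def)
  qed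
  then show ?thesis by (simp add: LIMSEQ_baire_iff baire_section_def)
qed

section \<open>The problems\<close>

definition cantor :: "baire set" where
  "cantor = {c. range c \<subseteq> {0, 1}}"

definition cantor_rep :: "baire \<rightharpoonup> baire" where
  "cantor_rep p = (if p \<in> cantor then Some p else None)"

definition two_rep :: "baire \<rightharpoonup> nat" where
  "two_rep p = (if p 0 \<in> {0, 1} then Some (p 0) else None)"

definition BWT2 :: "(baire, nat) problem" where
  "BWT2 = \<lparr>in_rep = cantor_rep, out_rep = two_rep,
     sol = (\<lambda>c. {b. c \<in> cantor \<and> infinite {n. c n = b}})\<rparr>"

definition RT12 :: "(baire, baire) problem" where
  "RT12 = \<lparr>in_rep = cantor_rep, out_rep = cantor_rep,
     sol = (\<lambda>c. {indicator M | M. c \<in> cantor \<and> infinite M \<and> c constant_on M})\<rparr>"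

lemma ran_cantor_rep: "ran cantor_rep = cantor"
  by (auto simp: ran_def cantor_rep_def)

lemma ran_two_rep: "ran two_rep = {0, 1}"
proof
  show "ran two_rep \<subseteq> {0, 1}" by (auto simp: ran_def two_rep_def split: if_splits)
  have "two_rep (\<lambda>_. b) = Some b" if "b \<in> {0, 1}" for b using that by (auto simp: two_rep_def)
  then show "{0, 1} \<subseteq> ran two_rep" unfolding ran_def by blast
qed

lemma baire_lim_surj: "ran baire_lim = UNIV"
proof -
  have "baire_lim (\<lambda>n. q (snd (prod_decode n))) = Some q" for q
    by (simp add: baire_lim_eq_Some_iff)
  then show ?thesis unfolding ran_def by blast
qed

lemma ran_in_rep_jump: "ran (in_rep (jump f)) = ran (in_rep f)"
proof
  show "ran (in_rep (jump f)) \<subseteq> ran (in_rep f)"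
    by (auto simp: jump_def ran_def map_comp_Some_iff)
  show "ran (in_rep f) \<subseteq> ran (in_rep (jump f))"
  proof
    fix x assume "x \<in> ran (in_rep f)"
    then obtain q where q: "in_rep f q = Some x" by (auto simp: ran_def)
    have "q \<in> ran baire_lim" by (simp add: baire_lim_surj)
    then obtain p where "baire_lim p = Some q" by (auto simp: ran_def)
    with q have "in_rep (jump f) p = Some x" by (simp add: jump_def)
    then show "x \<in> ran (in_rep (jump f))" unfolding ran_def by blast
  qed
qed

lemma well_formed_jump: "well_formed_problem f \<Longrightarrow> well_formed_problem (jump f)"
  unfolding well_formed_problem_def ran_in_rep_jump by (simp add: prob_dom_def jump_def)

lemma well_formed_BWT2: "well_formed_problem BWT2"
proof -
  have "b \<in> {0, 1}" if "c \<in> cantor" "infinite {n. c n = b}" for b c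
  proof -
    from that(2) obtain n where "c n = b" using not_finite_existsD by blast
    then show ?thesis using that(1) by (auto simp: cantor_def)
  qed
  then show ?thesis
    unfolding well_formed_problem_def prob_dom_def BWT2_def problem.simps ran_cantor_rep ran_two_rep
    by blast
qed

lemma well_formed_RT12: "well_formed_problem RT12"
proof -
  have "indicator M \<in> cantor" for M by (auto simp: cantor_def indicator_def)
  then show ?thesis
    unfolding well_formed_problem_def prob_dom_def RT12_def problem.simps ran_cantor_rep by blast
qed

lemma prob_dom_BWT2: "prob_dom BWT2 = cantor"
proof -
  have "\<exists>b. infinite {n. c n = b}" if "c \<in> cantor" for c
  proof (rule ccontr)
    assume "\<not> ?thesis"
    then have "finite ({n. c n = 0} \<union> {n. c n = 1})" by blast
    moreover have "{n. c n = 0} \<union> {n. c n = 1} = UNIV" using that by (auto simp: cantor_def)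
    ultimately show False using infinite_UNIV_nat by metis
  qed
  then show ?thesis by (auto simp: prob_dom_def BWT2_def)
qed

lemma prob_dom_RT12: "prob_dom RT12 = cantor"
proof -
  have "\<exists>M. infinite M \<and> c constant_on M" if "c \<in> cantor" for c
  proof -
    from that obtain b where "infinite {n. c n = b}"
      using prob_dom_BWT2 by (auto simp: prob_dom_def BWT2_def)
    moreover have "c constant_on {n. c n = b}" by (simp add: constant_on_def)
    ultimately show ?thesis by blast
  qed
  then show ?thesis by (auto simp: prob_dom_def RT12_def)
qed

end

theory Submission
  imports Defs
begin

text \<open>
  Only the continuity of the two reduction functions matters. Let \<open>D p\<close> be the coloring that the
  forward function assigns to a name \<open>p\<close>, and consider conditions that fix a finite part of a name
  together with the limits of finitely many of its columns.

  On a name of a sequence that is eventually \<open>b\<close>, the backward function must answer \<open>b\<close>, having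
  seen only a finite part of the name and of some homogeneous set above \<open>k\<close>.
  If the name is then continued to one of a sequence that is eventually \<open>1 - b\<close>, the answer is
  wrong, so the new coloring cannot be constant on \<open>{k..}\<close>. By iteration, below every condition
  there is a name \<open>p\<close> of a sequence that is eventually \<open>1\<close> such that \<open>D p\<close> takes both values
  infinitely often.

  On the other hand \<open>D p j\<close> is a pointwise limit of continuous functions of \<open>p\<close>, so every condition
  can be extended to one that decides \<open>D p j\<close>. Iterating this along a name of the zero sequence,
  take a color \<open>v\<close> that is decided infinitely often. The backward function answers \<open>0\<close> from
  finitely many positions decided as \<open>v\<close>, so for every further name of a sequence that is
  eventually \<open>1\<close> the color \<open>v\<close> occurs only finitely often. This is a contradiction.
\<close>

section \<open>Continuity of computable functions\<close>

text \<open>A halting computation queries its oracle only finitely often. Stating the bound as "for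
  all large \<open>m\<close>" lets the bounds of finitely many subcomputations be combined by
  intersecting eventual statements.\<close>

lemma ocomp_use:
  assumes "ocomp p e xs y"
  shows "\<forall>\<^sub>F m in sequentially. \<forall>q. (\<forall>x<m. q x = p x) \<longrightarrow> ocomp q e xs y"
  using assms
proof (induction rule: ocomp.induct)
  case (Oracle x xs)
  show ?case
    using eventually_gt_at_top[of x]
    by eventually_elim (metis ocomp.Oracle)
next
  case (Comp xs gs ys f z)
  have len: "length gs = length ys"
    using Comp.IH(1) by (rule list_all2_lengthD)
  have "\<forall>\<^sub>F m in sequentially. \<forall>i\<in>{..<length gs}.
      \<forall>q. (\<forall>x<m. q x = p x) \<longrightarrow> ocomp q (gs ! i) xs (ys ! i)"
    using Comp.IH(1) by (intro eventually_ball_finite) (auto simp: list_all2_conv_all_nth)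
  with Comp.IH(2) show ?case
    by eventually_elim (use len in \<open>auto intro!: ocomp.Comp simp: list_all2_conv_all_nth\<close>)
next
  case (PrimRec_0 f xs y g)
  from PrimRec_0.IH show ?case by eventually_elim (auto intro: ocomp.PrimRec_0)
next
  case (PrimRec_Suc f g n xs r y)
  from PrimRec_Suc.IH show ?case by eventually_elim (auto intro: ocomp.PrimRec_Suc)
next
  case (Mu n f xs)
  have "\<forall>\<^sub>F m in sequentially. \<forall>i\<in>{..<n}.
      \<exists>k. \<forall>q. (\<forall>x<m. q x = p x) \<longrightarrow> ocomp q f (i # xs) (Suc k)"
  proof (intro eventually_ball_finite ballI)
    fix i assume "i \<in> {..<n}"
    then obtain k where "\<forall>\<^sub>F m in sequentially.
        \<forall>q. (\<forall>x<m. q x = p x) \<longrightarrow> ocomp q f (i # xs) (Suc k)"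
      using Mu.IH(1) by blast
    then show "\<forall>\<^sub>F m in sequentially.
        \<exists>k. \<forall>q. (\<forall>x<m. q x = p x) \<longrightarrow> ocomp q f (i # xs) (Suc k)"
      by eventually_elim blast
  qed simp
  with Mu.IH(2) show ?case
  proof eventually_elim
    case (elim m)
    then show ?case by (intro allI impI ocomp.Mu) blast+
  qed
qed (auto intro: ocomp.intros intro!: always_eventually)

text \<open>The computation of \<open>r n\<close> reads only a prefix of \<open>p\<close>, and
  determinism identifies its result with \<open>s n\<close> on every \<open>q\<close> in the domain
  of \<open>F\<close> that shares this prefix.\<close>

lemma computable_baire_continuous:
  assumes "computable_baire F" "F p = Some r"
  shows "\<exists>m. \<forall>q s. (\<forall>x<m. q x = p x) \<longrightarrow> F q = Some s \<longrightarrow> s n = r n"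
proof -
  obtain e where e: "\<And>p q n. F p = Some q \<Longrightarrow> ocomp p e [n] (q n)"
    using assms(1) unfolding computable_baire_def by blast
  obtain m where m: "\<And>q. \<forall>x<m. q x = p x \<Longrightarrow> ocomp q e [n] (r n)"
    using ocomp_use[OF e[OF assms(2)], of n] unfolding eventually_sequentially by blast
  show ?thesis
    by (intro exI[of _ m] allI impI) (rule ocomp_deterministic[OF m e])
qed

section \<open>Names of binary sequences\<close>

definition names :: "baire \<Rightarrow> baire \<Rightarrow> bool" where
  "names p c \<longleftrightarrow> baire_lim p = Some c \<and> c \<in> cantor"

text \<open>For such names \<open>b\<close> is the only correct answer of the jump of
  \<open>BWT2\<close>.\<close>

definition names_ev :: "nat \<Rightarrow> baire \<Rightarrow> bool" where
  "names_ev b p \<longleftrightarrow> (\<exists>c. names p c \<and> (\<forall>\<^sub>F j in sequentially. c j = b))"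

lemma cantor_iff: "c \<in> cantor \<longleftrightarrow> (\<forall>n. c n = 0 \<or> c n = 1)"
  by (simp add: cantor_def image_subset_iff)

lemma eventually_sequentially_ge:
  assumes "\<forall>\<^sub>F s in sequentially. P s"
  obtains s where "s \<ge> k" "P s"
proof -
  have "\<forall>\<^sub>F s in sequentially. s \<ge> k \<and> P s"
    using eventually_ge_at_top[of k] assms by (rule eventually_conj)
  then show thesis using that by (auto simp: eventually_sequentially)
qed

lemma cantor_infinite_value:
  assumes "c \<in> cantor"
  obtains v where "v \<in> {0, 1}" "infinite {n. c n = v}"
proof -
  from assms obtain v where v: "infinite {n. c n = v}"
    using prob_dom_BWT2 by (auto simp: prob_dom_def BWT2_def)
  then have "\<exists>n. c n = v" using not_finite_existsD by blast
  with assms have "v \<in> {0, 1}" by (auto simp: cantor_iff)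
  with v show thesis using that by blast
qed

lemma eventually_value_unique:
  fixes c :: baire
  assumes "\<forall>\<^sub>F j in sequentially. c j = b" "infinite {n. c n = b'}"
  shows "b' = b"
proof -
  obtain N where N: "\<And>j. N \<le> j \<Longrightarrow> c j = b"
    using assms(1) by (auto simp: eventually_sequentially)
  obtain j where "j \<ge> N" "c j = b'"
    using assms(2) by (auto simp: infinite_nat_iff_unbounded_le)
  with N show ?thesis by auto
qed

section \<open>Conditions and their fusion\<close>

text \<open>
  Entry \<open>x\<close> of a name is an approximation to the value of the named sequence at
  \<open>snd (prod_decode x)\<close>. Thus \<open>cyl n p g\<close> is a condition that commits to the prefix of length \<open>n\<close>
  of \<open>p\<close> and to the limits \<open>g 0\<close>, ..., \<open>g (n - 1)\<close>, and leaves the other limits open.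
\<close>

definition cyl :: "nat \<Rightarrow> baire \<Rightarrow> baire \<Rightarrow> baire set" where
  "cyl n p g = {q. (\<forall>x<n. q x = p x) \<and>
     (\<forall>x\<ge>n. snd (prod_decode x) < n \<longrightarrow> q x = g (snd (prod_decode x)))}"

lemma cyl_agree: "q \<in> cyl n p g \<Longrightarrow> x < n \<Longrightarrow> q x = p x"
  by (simp add: cyl_def)

text \<open>Entries of \<open>q\<close> between \<open>n\<close> and \<open>n'\<close> that lie in
  the first \<open>n\<close> columns already equal their limits, so lengthening the prefix keeps the
  earlier commitments.\<close>

lemma cyl_subset:
  assumes "q \<in> cyl n p g" "n \<le> n'"
  shows "cyl n' q g \<subseteq> cyl n p g"
proof
  fix r assume r: "r \<in> cyl n' q g"
  have "r x = g (snd (prod_decode x))" if "n \<le> x" "snd (prod_decode x) < n" for x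
    using assms r that by (cases "x < n'") (auto simp: cyl_def)
  with assms r show "r \<in> cyl n p g" by (auto simp: cyl_def)
qed

lemma cyl_cong: "(\<And>j. j < n \<Longrightarrow> g j = h j) \<Longrightarrow> cyl n p g = cyl n p h"
  by (auto simp: cyl_def)

lemma names_mem_cyl:
  assumes "g \<in> cantor"
  obtains q where "names q g" "q \<in> cyl n p g"
proof -
  define q where "q x = (if x < n then p x else g (snd (prod_decode x)))" for x
  have "\<forall>\<^sub>F i in sequentially. q (prod_encode (i, j)) = g j" for j
    using eventually_ge_at_top[of n]
  proof eventually_elim
    case (elim i)
    have "i \<le> prod_encode (i, j)" by (rule le_prod_encode_1)
    with elim show ?case by (simp add: q_def)
  qed
  then have "names q g" using assms by (simp add: names_def baire_lim_eq_Some_iff)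
  moreover have "q \<in> cyl n p g" by (simp add: cyl_def q_def)
  ultimately show thesis by (rule that)
qed

text \<open>The condition sees \<open>g\<close> only below \<open>n\<close>, so the limit may be
  redefined as \<open>b\<close> from there on.\<close>

lemma names_ev_mem_cyl:
  assumes "g \<in> cantor" "b \<in> {0, 1}"
  obtains q where "names_ev b q" "q \<in> cyl n p g"
proof -
  let ?h = "\<lambda>j. if j < n then g j else b"
  have "?h \<in> cantor" using assms by (auto simp: cantor_iff)
  then obtain q where q: "names q ?h" "q \<in> cyl n p ?h" by (rule names_mem_cyl)
  have "\<forall>\<^sub>F j in sequentially. ?h j = b"
    using eventually_ge_at_top[of n] by eventually_elim simp
  with q(1) have "names_ev b q" unfolding names_ev_def by blast
  moreover have "q \<in> cyl n p g" using q(2) cyl_cong[of n g ?h p] by simp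
  ultimately show thesis by (rule that)
qed

text \<open>A fusion argument: conditions are extended so as to meet \<open>Q 0\<close>,
  \<open>Q 1\<close>, ... in turn. Since their lengths grow strictly, every column is eventually
  committed to its limit, so the common extension names \<open>g\<close>.\<close>

lemma cyl_fusion:
  fixes Q :: "nat \<Rightarrow> nat \<Rightarrow> baire \<Rightarrow> bool"
  assumes g: "g \<in> cantor"
    and step: "\<And>k n p. cyl n p g \<subseteq> cyl n0 p0 g \<Longrightarrow> \<exists>n'>n. \<exists>p'\<in>cyl n p g. Q k n' p'"
  shows "\<exists>q\<in>cyl n0 p0 g. names q g \<and> (\<forall>k. \<exists>n' p'. Q k n' p' \<and> q \<in> cyl n' p' g)"
proof -
  define R where "R = (\<lambda>k (n, p) (n', p'). n < n' \<and> p' \<in> cyl n p g \<and> Q k n' p')"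
  \<comment> \<open>The clause for \<open>k = 0\<close> pins the start of the sequence to the given
    condition.\<close>
  have "\<exists>f. \<forall>k. (case f k of (n, p) \<Rightarrow> cyl n p g \<subseteq> cyl n0 p0 g \<and> (k = 0 \<longrightarrow> n = n0 \<and> p = p0))
      \<and> R k (f k) (f (Suc k))"
  proof (rule dependent_nat_choice)
    fix x :: "nat \<times> baire" and k :: nat
    assume x: "case x of (n, p) \<Rightarrow> cyl n p g \<subseteq> cyl n0 p0 g \<and> (k = 0 \<longrightarrow> n = n0 \<and> p = p0)"
    obtain n p where np: "x = (n, p)" by (cases x)
    from x np obtain n' p' where *: "n' > n" "p' \<in> cyl n p g" "Q k n' p'"
      using step by blast
    then have "cyl n' p' g \<subseteq> cyl n0 p0 g"
      using cyl_subset[of p' n p g n'] x np by auto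
    with * np show "\<exists>y. (case y of (n, p) \<Rightarrow>
        cyl n p g \<subseteq> cyl n0 p0 g \<and> (Suc k = 0 \<longrightarrow> n = n0 \<and> p = p0)) \<and> R k x y"
      by (intro exI[of _ "(n', p')"]) (simp add: R_def)
  qed auto
  then obtain f where f: "\<And>k. case f k of (n, p) \<Rightarrow> k = 0 \<longrightarrow> n = n0 \<and> p = p0"
      "\<And>k. R k (f k) (f (Suc k))"
    by (auto simp: split_beta)
  define n where "n k = fst (f k)" for k
  define p where "p k = snd (f k)" for k
  have start: "n 0 = n0" "p 0 = p0" using f(1)[of 0] by (auto simp: n_def p_def split_beta)
  have less: "n k < n (Suc k)" and ext: "p (Suc k) \<in> cyl (n k) (p k) g"
    and Q: "Q k (n (Suc k)) (p (Suc k))" for k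
    using f(2)[of k] by (auto simp: R_def n_def p_def split_beta)
  have mono: "strict_mono n" using less by (rule strict_monoI_Suc)
  have sub: "cyl (n l) (p l) g \<subseteq> cyl (n k) (p k) g" if "k \<le> l" for k l
    using that
  proof (induction l rule: dec_induct)
    case (step l)
    then show ?case using cyl_subset[OF ext less_imp_le[OF less], of l] by blast
  qed simp
  have mem: "p l \<in> cyl (n k) (p k) g" if "k < l" for k l
    using that ext[of "l - 1"] sub[of k "l - 1"] by (cases l) auto
  \<comment> \<open>Entry \<open>x\<close> is frozen from stage \<open>Suc x\<close> on, because
    \<open>x < n (Suc x)\<close>.\<close>
  define q where "q x = p (Suc x) x" for x
  have agree: "p l x = q x" if "x < l" for l x
  proof (cases "l = Suc x")
    case False
    have "x < n (Suc x)" using strict_mono_imp_increasing[OF mono, of "Suc x"] by simp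
    then show ?thesis using mem[of "Suc x" l] that False by (auto simp: q_def cyl_def)
  qed (simp add: q_def)
  have q: "q \<in> cyl (n k) (p k) g" for k
  proof -
    have "q x = p (k + Suc x) x" for x using agree[of x "k + Suc x"] by simp
    moreover have "p (k + Suc x) \<in> cyl (n k) (p k) g" for x by (rule mem) simp
    ultimately show ?thesis by (simp add: cyl_def)
  qed
  have "\<forall>\<^sub>F i in sequentially. q (prod_encode (i, j)) = g j" for j
    using eventually_ge_at_top[of "n (Suc j)"]
  proof eventually_elim
    case (elim i)
    have "i \<le> prod_encode (i, j)" by (rule le_prod_encode_1)
    moreover have "j < n (Suc j)" using strict_mono_imp_increasing[OF mono, of "Suc j"] by simp
    ultimately show ?case using elim q[of "Suc j"] by (simp add: cyl_def)
  qed
  then have "names q g" using g by (simp add: names_def baire_lim_eq_Some_iff)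
  moreover have "q \<in> cyl n0 p0 g" using q[of 0] start by simp
  ultimately show ?thesis using q Q by blast
qed

section \<open>Continuous reductions\<close>

text \<open>Here \<open>D p\<close> is the coloring passed to the jump of \<open>RT12\<close>, and
  \<open>\<kappa> s p\<close> is the approximation to it at stage \<open>s\<close>. In
  \<open>backward\<close>, \<open>b\<close> is the answer computed from \<open>p\<close> and
  \<open>M\<close>, and \<open>m\<close> bounds the part of both that is read, so the same answer
  must be correct for every \<open>q\<close> and \<open>N\<close> that look alike below
  \<open>m\<close>.\<close>

locale continuous_reduction =
  fixes D :: "baire \<Rightarrow> baire" and \<kappa> :: "nat \<Rightarrow> baire \<Rightarrow> baire"
  assumes D_cantor: "names p c \<Longrightarrow> D p \<in> cantor"
    and D_limit: "names p c \<Longrightarrow> \<forall>\<^sub>F s in sequentially. \<kappa> s p j = D p j"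
    and \<kappa>_continuous: "names p c \<Longrightarrow>
      \<exists>m. \<forall>q d. names q d \<longrightarrow> (\<forall>x<m. q x = p x) \<longrightarrow> \<kappa> s q j = \<kappa> s p j"
    and backward: "names p c \<Longrightarrow> infinite M \<Longrightarrow> D p constant_on M \<Longrightarrow>
      \<exists>b m. infinite {n. c n = b} \<and>
        (\<forall>q d N. names q d \<longrightarrow> infinite N \<longrightarrow> D q constant_on N \<longrightarrow> (\<forall>x<m. q x = p x) \<longrightarrow>
          (\<forall>x<m. x \<in> N \<longleftrightarrow> x \<in> M) \<longrightarrow> infinite {n. d n = b})"
begin

section \<open>Density of names whose coloring takes a given value infinitely often\<close>

text \<open>The answer for \<open>p\<close> and \<open>M\<close> can only be \<open>b\<close>. If
  \<open>N\<close> were homogeneous for \<open>D q\<close>, the same answer would be given for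
  \<open>q\<close>, where only \<open>b'\<close> is correct.\<close>

lemma backward_ev:
  assumes p: "names_ev b p" and M: "infinite M" "D p constant_on M"
  shows "\<exists>m. \<forall>q b' N. names_ev b' q \<longrightarrow> b' \<noteq> b \<longrightarrow> infinite N \<longrightarrow> (\<forall>x<m. q x = p x) \<longrightarrow>
    (\<forall>x<m. x \<in> N \<longleftrightarrow> x \<in> M) \<longrightarrow> \<not> D q constant_on N"
proof -
  obtain c where c: "names p c" "\<forall>\<^sub>F j in sequentially. c j = b"
    using p by (auto simp: names_ev_def)
  from backward[OF c(1) M] obtain a m where a: "infinite {n. c n = a}"
    and m: "\<forall>q d N. names q d \<longrightarrow> infinite N \<longrightarrow> D q constant_on N \<longrightarrow> (\<forall>x<m. q x = p x) \<longrightarrow>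
      (\<forall>x<m. x \<in> N \<longleftrightarrow> x \<in> M) \<longrightarrow> infinite {n. d n = a}"
    by (elim exE conjE)
  have "a = b" using c(2) a by (rule eventually_value_unique)
  show ?thesis
  proof (intro exI[of _ m] allI impI notI)
    fix q b' N
    assume *: "names_ev b' q" "b' \<noteq> b" "infinite N" "\<forall>x<m. q x = p x"
      "\<forall>x<m. x \<in> N \<longleftrightarrow> x \<in> M" "D q constant_on N"
    obtain d where d: "names q d" "\<forall>\<^sub>F j in sequentially. d j = b'"
      using *(1) by (auto simp: names_ev_def)
    have "infinite {n. d n = a}"
      using m[rule_format, OF d(1) *(3,6)] *(4,5) by simp
    with d(2) have "a = b'" by (rule eventually_value_unique)
    with \<open>a = b\<close> *(2) show False by simp
  qed
qed

lemma forces_value: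
  assumes p: "names_ev b p" and v: "v \<in> {0, 1}"
  shows "\<exists>m. \<forall>q b'. names_ev b' q \<longrightarrow> b' \<noteq> b \<longrightarrow> (\<forall>x<m. q x = p x) \<longrightarrow> (\<exists>j\<ge>k. D q j = v)"
proof -
  obtain c where c: "names p c" using p by (auto simp: names_ev_def)
  obtain w where w: "infinite {j. D p j = w}"
    using D_cantor[OF c] by (rule cantor_infinite_value)
  \<comment> \<open>Removing the positions below \<open>k\<close> allows a set contained in
    \<open>{k..}\<close> to agree with \<open>M\<close> below \<open>m\<close>.\<close>
  define M where "M = {j. D p j = w} - {..<k}"
  have M: "infinite M" using w by (simp add: M_def Diff_infinite_finite)
  have "D p constant_on M" by (auto simp: M_def constant_on_def)
  from backward_ev[OF p M this] obtain m where
    m: "\<forall>q b' N. names_ev b' q \<longrightarrow> b' \<noteq> b \<longrightarrow> infinite N \<longrightarrow> (\<forall>x<m. q x = p x) \<longrightarrow>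
      (\<forall>x<m. x \<in> N \<longleftrightarrow> x \<in> M) \<longrightarrow> \<not> D q constant_on N"
    by (elim exE)
  show ?thesis
  proof (rule exI[of _ m], intro allI impI, rule ccontr)
    fix q b'
    assume *: "names_ev b' q" "b' \<noteq> b" "\<forall>x<m. q x = p x" "\<not> (\<exists>j\<ge>k. D q j = v)"
    obtain d where "names q d" using *(1) by (auto simp: names_ev_def)
    then have "D q \<in> cantor" by (rule D_cantor)
    then have D: "D q j = 0 \<or> D q j = 1" for j by (simp add: cantor_iff)
    \<comment> \<open>\<open>N\<close> copies \<open>M\<close> below \<open>m\<close> and contains
      everything from \<open>max k m\<close> on. If \<open>D q\<close> omits \<open>v\<close> from
      \<open>k\<close> on, it is constantly \<open>1 - v\<close> on \<open>N\<close>, although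
      \<open>N\<close> looks like \<open>M\<close> to the backward function.\<close>
    define N where "N = {j \<in> {k..}. j < m \<longrightarrow> j \<in> M}"
    have "{max k m..} \<subseteq> N" by (auto simp: N_def)
    then have "infinite N" using infinite_Ici infinite_super by blast
    moreover have "\<forall>x<m. x \<in> N \<longleftrightarrow> x \<in> M" by (auto simp: N_def M_def)
    ultimately have "\<not> D q constant_on N"
      using m[rule_format, OF *(1,2)] *(3) by simp
    moreover have "D q j = 1 - v" if "j \<in> N" for j
      using that *(4) D[of j] v by (auto simp: N_def)
    ultimately show False by (auto simp: constant_on_def)
  qed
qed

text \<open>Fusion towards a sequence that is eventually \<open>b\<close>, where stage
  \<open>k\<close> forces the value \<open>v\<close> to occur at some position from \<open>k\<close>
  on.\<close>

lemma both_values_dense: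
  assumes g: "g \<in> cantor" and v: "v \<in> {0, 1}" and b: "b \<in> {0, 1}"
  shows "\<exists>q\<in>cyl n p g. names_ev b q \<and> infinite {j. D q j = v}"
proof -
  let ?h = "\<lambda>j. if j < n then g j else b"
  have h: "?h \<in> cantor" using g b by (auto simp: cantor_iff)
  have ev: "\<forall>\<^sub>F j in sequentially. ?h j = b"
    using eventually_ge_at_top[of n] by eventually_elim simp
  define Q where "Q k n' p' \<longleftrightarrow> (\<forall>q\<in>cyl n' p' ?h. names_ev b q \<longrightarrow> (\<exists>j\<ge>k. D q j = v))"
    for k n' p'
  have "\<exists>n'>n1. \<exists>p'\<in>cyl n1 p1 ?h. Q k n' p'" for k n1 p1
  proof -
    \<comment> \<open>The name \<open>r\<close> has the opposite eventual value, as
      \<open>forces_value\<close> requires. Only a prefix of it is kept; the committed limits remain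
      those of \<open>?h\<close>.\<close>
    have "1 - b \<in> {0, 1}" using b by auto
    with h obtain r where r: "names_ev (1 - b) r" "r \<in> cyl n1 p1 ?h"
      by (rule names_ev_mem_cyl)
    from forces_value[OF r(1) v, of k] obtain m where
      m: "\<forall>q b'. names_ev b' q \<longrightarrow> b' \<noteq> 1 - b \<longrightarrow> (\<forall>x<m. q x = r x) \<longrightarrow> (\<exists>j\<ge>k. D q j = v)"
      by (elim exE)
    have "b \<noteq> 1 - b" using b by auto
    have "Q k (max m (Suc n1)) r"
      unfolding Q_def
    proof (intro ballI impI)
      fix q assume q: "q \<in> cyl (max m (Suc n1)) r ?h" "names_ev b q"
      have "\<forall>x<m. q x = r x" using cyl_agree[OF q(1)] by simp
      then show "\<exists>j\<ge>k. D q j = v" using m[rule_format, OF q(2) \<open>b \<noteq> 1 - b\<close>] by simp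
    qed
    with r(2) show ?thesis by (intro exI[of _ "max m (Suc n1)"]) auto
  qed
  then obtain q where q: "names q ?h" "q \<in> cyl n p ?h"
    "\<And>k. \<exists>n' p'. Q k n' p' \<and> q \<in> cyl n' p' ?h"
    using cyl_fusion[OF h, of n p Q] by blast
  have nq: "names_ev b q" using q(1) ev unfolding names_ev_def by blast
  show ?thesis
  proof (intro bexI conjI)
    show "names_ev b q" by (fact nq)
    show "q \<in> cyl n p g" using q(2) cyl_cong[of n g ?h p] by simp
    show "infinite {j. D q j = v}"
      unfolding infinite_nat_iff_unbounded_le using q(3) nq unfolding Q_def by blast
  qed
qed

section \<open>Deciding colors, and the contradiction\<close>

text \<open>Otherwise one could build a name along which the approximations to \<open>D q j\<close> change forever.\<close>

lemma ex_deciding_cyl: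
  assumes g: "g \<in> cantor"
  shows "\<exists>n'>n. \<exists>p'\<in>cyl n p g. \<exists>v. \<forall>q\<in>cyl n' p' g. \<forall>c. names q c \<longrightarrow> D q j = v"
proof (rule ccontr)
  assume "\<not> ?thesis"
  then have undec: "\<exists>q\<in>cyl n' p' g. \<exists>c. names q c \<and> D q j \<noteq> v"
    if "n < n'" "p' \<in> cyl n p g" for n' p' v
    using that by blast
  define Q where "Q k n' p' \<longleftrightarrow>
    (\<forall>q\<in>cyl n' p' g. names q g \<longrightarrow> (\<exists>s\<ge>k. \<exists>t\<ge>k. \<kappa> s q j \<noteq> \<kappa> t q j))" for k n' p'
  have "\<exists>n'>n1. \<exists>p'\<in>cyl n1 p1 g. Q k n' p'" if sub: "cyl n1 p1 g \<subseteq> cyl n p g" for k n1 p1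
  proof -
    obtain r where r: "names r g" "r \<in> cyl n1 p1 g" using g by (rule names_mem_cyl)
    obtain s where s: "s \<ge> k" "\<kappa> s r j = D r j"
      using D_limit[OF r(1), of j] by (rule eventually_sequentially_ge)
    from \<kappa>_continuous[OF r(1), of s j] obtain m where
      m: "\<forall>q d. names q d \<longrightarrow> (\<forall>x<m. q x = r x) \<longrightarrow> \<kappa> s q j = D r j"
      unfolding s(2) by (elim exE)
    \<comment> \<open>Length \<open>m\<close> preserves the approximation found at \<open>r\<close>,
      length above \<open>n\<close> makes \<open>undec\<close> applicable, and length above
      \<open>n1\<close> is the progress needed for fusion.\<close>
    define n2 where "n2 = max m (Suc (max n n1))"
    have n2: "m \<le> n2" "n < n2" "n1 < n2" by (auto simp: n2_def)
    obtain r' c where r': "r' \<in> cyl n2 r g" "names r' c" "D r' j \<noteq> D r j"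
      using undec[of n2 r "D r j"] r(2) sub n2 by blast
    obtain t where t: "t \<ge> k" "\<kappa> t r' j = D r' j"
      using D_limit[OF r'(2), of j] by (rule eventually_sequentially_ge)
    from \<kappa>_continuous[OF r'(2), of t j] obtain m' where
      m': "\<forall>q d. names q d \<longrightarrow> (\<forall>x<m'. q x = r' x) \<longrightarrow> \<kappa> t q j = D r' j"
      unfolding t(2) by (elim exE)
    define n3 where "n3 = max m' n2"
    have "Q k n3 r'"
      unfolding Q_def
    proof (intro ballI impI)
      fix q assume q: "q \<in> cyl n3 r' g" "names q g"
      have "\<forall>x<m. q x = r x"
        using cyl_agree[OF q(1)] cyl_agree[OF r'(1)] n2(1) by (simp add: n3_def)
      moreover have "\<forall>x<m'. q x = r' x" using cyl_agree[OF q(1)] by (auto simp: n3_def)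
      ultimately have "\<kappa> s q j \<noteq> \<kappa> t q j"
        using m[rule_format, OF q(2)] m'[rule_format, OF q(2)] r'(3) by simp
      then show "\<exists>s\<ge>k. \<exists>t\<ge>k. \<kappa> s q j \<noteq> \<kappa> t q j" using s(1) t(1) by blast
    qed
    moreover have "r' \<in> cyl n1 p1 g"
      using cyl_subset[OF r(2) less_imp_le[OF n2(3)]] r'(1) by blast
    moreover have "n3 > n1" using n2(3) by (simp add: n3_def)
    ultimately show ?thesis by blast
  qed
  then obtain q where q: "names q g" "\<And>k. \<exists>n' p'. Q k n' p' \<and> q \<in> cyl n' p' g"
    using cyl_fusion[OF g, of n p Q] by blast
  obtain k where "\<And>s. s \<ge> k \<Longrightarrow> \<kappa> s q j = D q j"
    using D_limit[OF q(1), of j] by (auto simp: eventually_sequentially)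
  moreover obtain s t where "s \<ge> k" "t \<ge> k" "\<kappa> s q j \<noteq> \<kappa> t q j"
    using q(2)[of k] q(1) unfolding Q_def by blast
  ultimately show False by simp
qed

text \<open>A name \<open>p\<close> of the zero sequence is built whose prefixes decide every
  \<open>D p j\<close>. For a color \<open>v\<close> occurring infinitely often, the answer
  \<open>0\<close> depends on finitely many decided positions. A compatible name with eventual value
  \<open>1\<close> and infinitely many \<open>v\<close> would receive the same, wrong
  answer.\<close>

lemma finite_value_below:
  "\<exists>n p. \<exists>v\<in>{0, 1}. \<forall>q\<in>cyl n p (\<lambda>_. 0). names_ev 1 q \<longrightarrow> finite {j. D q j = v}"
proof -
  let ?z = "\<lambda>_::nat. 0::nat"
  have z: "?z \<in> cantor" by (auto simp: cantor_iff)
  define Q where "Q j n' p' \<longleftrightarrow> (\<exists>v. \<forall>q\<in>cyl n' p' ?z. \<forall>c. names q c \<longrightarrow> D q j = v)" for j n' p'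
  have step: "\<exists>n'>n. \<exists>p'\<in>cyl n p ?z. Q j n' p'" for n p j
    using ex_deciding_cyl[OF z, of n p j] unfolding Q_def .
  have "\<exists>p\<in>cyl 0 ?z ?z. names p ?z \<and> (\<forall>j. \<exists>n' p'. Q j n' p' \<and> p \<in> cyl n' p' ?z)"
    using z step by (rule cyl_fusion)
  then obtain p where p: "names p ?z" "\<forall>j. \<exists>n' p'. Q j n' p' \<and> p \<in> cyl n' p' ?z"
    by (elim bexE conjE)
  \<comment> \<open>The deciding conditions are recentered at \<open>p\<close>, so that they differ
    only in length and can be merged.\<close>
  have "\<forall>j. \<exists>n. p \<in> cyl n p ?z \<and> (\<forall>q\<in>cyl n p ?z. \<forall>c. names q c \<longrightarrow> D q j = D p j)"
  proof
    fix j
    obtain n' p' where *: "Q j n' p'" "p \<in> cyl n' p' ?z" using p(2) by blast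
    from *(1) obtain w where w: "\<forall>q\<in>cyl n' p' ?z. \<forall>c. names q c \<longrightarrow> D q j = w"
      unfolding Q_def by (elim exE)
    have "D p j = w" using w[rule_format, OF *(2) p(1)] .
    moreover have "cyl n' p ?z \<subseteq> cyl n' p' ?z" using *(2) order_refl by (rule cyl_subset)
    ultimately have "\<forall>q\<in>cyl n' p ?z. \<forall>c. names q c \<longrightarrow> D q j = D p j" using w by blast
    moreover have "p \<in> cyl n' p ?z" using *(2) by (simp add: cyl_def)
    ultimately show "\<exists>n. p \<in> cyl n p ?z \<and> (\<forall>q\<in>cyl n p ?z. \<forall>c. names q c \<longrightarrow> D q j = D p j)"
      by (intro exI[of _ n'] conjI)
  qed
  from choice[OF this] obtain n where
    n: "\<forall>j. p \<in> cyl (n j) p ?z \<and> (\<forall>q\<in>cyl (n j) p ?z. \<forall>c. names q c \<longrightarrow> D q j = D p j)"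
    by (elim exE)
  obtain v where v: "v \<in> {0, 1}" "infinite {j. D p j = v}"
    using cantor_infinite_value[OF D_cantor[OF p(1)]] by blast
  have zero: "names_ev 0 p" unfolding names_ev_def using p(1) by (intro exI[of _ ?z]) simp
  have "D p constant_on {j. D p j = v}" by (auto simp: constant_on_def)
  from backward_ev[OF zero v(2) this] obtain m where
    m: "\<forall>q b' N. names_ev b' q \<longrightarrow> b' \<noteq> 0 \<longrightarrow> infinite N \<longrightarrow>
      (\<forall>x<m. q x = p x) \<longrightarrow> (\<forall>x<m. x \<in> N \<longleftrightarrow> x \<in> {j. D p j = v}) \<longrightarrow> \<not> D q constant_on N"
    by (elim exE)
  \<comment> \<open>The sum dominates each \<open>n j\<close> with \<open>j < m\<close>, so
    \<open>D q\<close> is decided below \<open>m\<close>; the summand \<open>m\<close> covers the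
    part of the name that is read.\<close>
  define N where "N = m + (\<Sum>j<m. n j)"
  show ?thesis
  proof (intro exI bexI[OF _ v(1)] ballI impI)
    fix q assume q: "q \<in> cyl N p ?z" "names_ev 1 q"
    obtain c where c: "names q c" using q(2) by (auto simp: names_ev_def)
    have agree: "D q j = D p j" if "j < m" for j
    proof -
      have "n j \<le> (\<Sum>j<m. n j)" using that by (intro member_le_sum) auto
      then have "cyl N p ?z \<subseteq> cyl (n j) p ?z" using n by (intro cyl_subset) (simp_all add: N_def)
      then have "q \<in> cyl (n j) p ?z" using q(1) by (rule subsetD)
      then show ?thesis using n c by blast
    qed
    have const: "D q constant_on {j. D q j = v}" by (auto simp: constant_on_def)
    show "finite {j. D q j = v}"
    proof (rule ccontr)
      assume "infinite {j. D q j = v}"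
      moreover have "\<forall>x<m. q x = p x" using cyl_agree[OF q(1)] by (simp add: N_def)
      ultimately show False
        using m[rule_format, OF q(2) one_neq_zero, of "{j. D q j = v}"] agree const by simp
    qed
  qed
qed

lemma no_continuous_reduction: False
proof -
  from finite_value_below obtain n p v where v: "v \<in> {0, 1}"
    and fin: "\<forall>q\<in>cyl n p (\<lambda>_. 0). names_ev 1 q \<longrightarrow> finite {j. D q j = v}"
    by (elim exE bexE)
  have "\<exists>q\<in>cyl n p (\<lambda>_. 0). names_ev 1 q \<and> infinite {j. D q j = v}"
    using v by (intro both_values_dense) (simp_all add: cantor_iff)
  with fin show False by blast
qed

end

section \<open>Weihrauch reductions are continuous reductions\<close>

lemma in_rep_jump_iff_names:
  "in_rep (jump BWT2) p = Some c \<longleftrightarrow> names p c" "in_rep (jump RT12) p = Some c \<longleftrightarrow> names p c"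
  by (auto simp: jump_def BWT2_def RT12_def names_def cantor_rep_def map_comp_Some_iff)

lemma realizes_jump_BWT2D:
  assumes "realizes F (jump BWT2)" "names p c"
  shows "\<exists>q. F p = Some q \<and> infinite {n. c n = q 0}"
proof -
  have "c \<in> prob_dom (jump BWT2)"
    using assms(2) prob_dom_BWT2 by (simp add: prob_dom_def jump_def names_def)
  with assms obtain q y where
    "F p = Some q" "out_rep (jump BWT2) q = Some y" "y \<in> sol (jump BWT2) c"
    unfolding realizes_def in_rep_jump_iff_names by blast
  then show ?thesis
    by (auto simp: jump_def BWT2_def two_rep_def split: if_splits)
qed

lemma realizes_jump_RT12I:
  assumes "\<And>p c. names p c \<Longrightarrow>
    \<exists>M. F p = Some (indicator M) \<and> infinite M \<and> c constant_on M"
  shows "realizes F (jump RT12)"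
  unfolding realizes_def in_rep_jump_iff_names
proof (intro allI impI)
  fix p c assume p: "names p c"
  then obtain M where M: "F p = Some (indicator M)" "infinite M" "c constant_on M"
    using assms by blast
  have "(indicator M :: baire) \<in> cantor" by (simp add: cantor_iff indicator_def)
  then have "out_rep (jump RT12) (indicator M) = Some (indicator M)"
    by (simp add: jump_def RT12_def cantor_rep_def)
  moreover have "indicator M \<in> sol (jump RT12) c"
    using p M by (auto simp: jump_def RT12_def names_def)
  ultimately show "\<exists>q y. F p = Some q \<and> out_rep (jump RT12) q = Some y \<and> y \<in> sol (jump RT12) c"
    using M(1) by blast
qed

text \<open>A realizer may be chosen freely at each name, so any infinite homogeneous set can be
  prescribed at \<open>r\<close>. Leaving it undefined off the names makes definedness of
  \<open>G s\<close> detect that \<open>s\<close> is a name.\<close>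

lemma realizer_jump_RT12:
  assumes r: "names r d" and M: "infinite M" "d constant_on M"
  shows "\<exists>G. realizes G (jump RT12) \<and> G r = Some (indicator M) \<and>
    (\<forall>s. G s \<noteq> None \<longrightarrow> (\<exists>e. names s e))"
proof -
  define P where "P e q \<longleftrightarrow> (\<exists>M. q = Some (indicator M :: baire) \<and> infinite M \<and> e constant_on M)"
    for e :: baire and q
  have unique: "e' = e" if "names s e" "names s e'" for s e e'
    using that by (simp add: names_def)
  have "\<forall>s. \<exists>q. (\<forall>e. names s e \<longrightarrow> P e q) \<and> (q \<noteq> None \<longrightarrow> (\<exists>e. names s e)) \<and>
    (s = r \<longrightarrow> q = Some (indicator M))"
  proof
    fix s
    consider "s = r" | "s \<noteq> r" "\<exists>e. names s e" | "s \<noteq> r" "\<nexists>e. names s e" by blast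
    then show "\<exists>q. (\<forall>e. names s e \<longrightarrow> P e q) \<and> (q \<noteq> None \<longrightarrow> (\<exists>e. names s e)) \<and>
      (s = r \<longrightarrow> q = Some (indicator M))"
    proof cases
      case 1
      have "P d (Some (indicator M))" unfolding P_def using M by blast
      then have "\<forall>e. names s e \<longrightarrow> P e (Some (indicator M))" using r unique 1 by blast
      then show ?thesis using r 1 by blast
    next
      case 2
      then obtain e where e: "names s e" by blast
      then have "e \<in> cantor" by (simp add: names_def)
      then obtain v where v: "infinite {n. e n = v}" by (rule cantor_infinite_value)
      have "e constant_on {n. e n = v}" by (auto simp: constant_on_def)
      with v have "P e (Some (indicator {n. e n = v}))" unfolding P_def by blast
      then have "\<forall>e'. names s e' \<longrightarrow> P e' (Some (indicator {n. e n = v}))"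
        using e unique by blast
      then show ?thesis using e 2 by blast
    qed blast
  qed
  from choice[OF this] obtain G where
    G: "\<forall>s. (\<forall>e. names s e \<longrightarrow> P e (G s)) \<and> (G s \<noteq> None \<longrightarrow> (\<exists>e. names s e)) \<and>
      (s = r \<longrightarrow> G s = Some (indicator M))"
    by (elim exE)
  have "realizes G (jump RT12)"
    by (rule realizes_jump_RT12I) (use G in \<open>simp add: P_def\<close>)
  with G show ?thesis by blast
qed

lemma weihrauch_le_imp_continuous_reduction:
  assumes "jump BWT2 \<le>\<^sub>W jump RT12"
  shows "\<exists>D \<kappa>. continuous_reduction D \<kappa>"
proof -
  obtain H K where HK: "computable_baire H" "computable_baire K"
    and "\<forall>G. realizes G (jump RT12) \<longrightarrow> realizes
      (\<lambda>p. case (G \<circ>\<^sub>m K) p of None \<Rightarrow> None | Some q \<Rightarrow> H (baire_pair p q)) (jump BWT2)"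
    using assms unfolding weihrauch_le_def by blast
  note red = realizes_jump_BWT2D[OF this(3)[rule_format]]
  \<comment> \<open>The zero instance supplies a realizer \<open>G0\<close> defined only on names.
    The composite with \<open>G0\<close> must be defined on every name \<open>p\<close>, so
    \<open>K p\<close> is itself a name.\<close>
  have "names (\<lambda>_. 0) (\<lambda>_. 0)"
    by (simp add: names_def baire_lim_eq_Some_iff cantor_iff)
  then have "\<exists>G. realizes G (jump RT12) \<and> G (\<lambda>_. 0) = Some (indicator UNIV) \<and>
    (\<forall>s. G s \<noteq> None \<longrightarrow> (\<exists>e. names s e))"
    by (rule realizer_jump_RT12) (auto simp: constant_on_def)
  then obtain G0 where G0: "realizes G0 (jump RT12)" "\<forall>s. G0 s \<noteq> None \<longrightarrow> (\<exists>e. names s e)"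
    by (elim exE conjE)
  have "\<forall>p. \<exists>x. \<forall>c. names p c \<longrightarrow> K p = Some (fst x) \<and> names (fst x) (snd x)"
  proof
    fix p
    show "\<exists>x. \<forall>c. names p c \<longrightarrow> K p = Some (fst x) \<and> names (fst x) (snd x)"
    proof (cases "\<exists>c. names p c")
      case True
      then obtain c where "names p c" ..
      from red[OF G0(1) this] obtain r where "K p = Some r" "G0 r \<noteq> None"
        by (auto simp: map_comp_def split: option.splits)
      moreover from this(2) G0(2) obtain d where "names r d" by blast
      ultimately show ?thesis by (intro exI[of _ "(r, d)"]) simp
    qed simp
  qed
  from choice[OF this] obtain f where
    f: "\<forall>p c. names p c \<longrightarrow> K p = Some (fst (f p)) \<and> names (fst (f p)) (snd (f p))"
    by (elim exE)
  define k where "k p = fst (f p)" for p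
  define D where "D p = snd (f p)" for p
  have kD: "K p = Some (k p) \<and> names (k p) (D p)" if "names p c" for p c
    unfolding k_def D_def using f that by blast
  \<comment> \<open>For each homogeneous \<open>M\<close> a realizer returning \<open>M\<close> at
    \<open>k p\<close> is used, so \<open>H\<close> must succeed on all of them.\<close>
  have H: "\<exists>q. H (baire_pair p (indicator M)) = Some q \<and> infinite {n. c n = q 0}"
    if p: "names p c" and M: "infinite M" "D p constant_on M" for p c M
  proof -
    from kD[OF p] have K: "K p = Some (k p)" and D: "names (k p) (D p)"
      by (rule conjunct1, rule conjunct2)
    from realizer_jump_RT12[OF D M] obtain G
      where G: "realizes G (jump RT12)" "G (k p) = Some (indicator M)"
      by (elim exE conjE)
    have "(case (G \<circ>\<^sub>m K) p of None \<Rightarrow> None | Some q \<Rightarrow> H (baire_pair p q)) =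
        H (baire_pair p (indicator M))"
      by (simp add: K G(2))
    then show ?thesis using red[OF G(1) p] by (simp only:)
  qed
  have "continuous_reduction D (\<lambda>s p j. k p (prod_encode (s, j)))"
  proof
    fix p c assume p: "names p c"
    show "D p \<in> cantor" using kD[OF p] by (simp add: names_def)
    show "\<forall>\<^sub>F s in sequentially. k p (prod_encode (s, j)) = D p j" for j
      using kD[OF p] by (simp add: names_def baire_lim_eq_Some_iff)
    show "\<exists>m. \<forall>q d. names q d \<longrightarrow> (\<forall>x<m. q x = p x) \<longrightarrow>
        k q (prod_encode (s, j)) = k p (prod_encode (s, j))" for s j
    proof -
      from computable_baire_continuous[OF HK(2) conjunct1[OF kD[OF p]], of "prod_encode (s, j)"]
      obtain m where m: "\<forall>q r. (\<forall>x<m. q x = p x) \<longrightarrow> K q = Some r \<longrightarrow>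
          r (prod_encode (s, j)) = k p (prod_encode (s, j))"
        by (elim exE)
      show ?thesis
      proof (intro exI[of _ m] allI impI)
        fix q d assume q: "names q d" "\<forall>x<m. q x = p x"
        show "k q (prod_encode (s, j)) = k p (prod_encode (s, j))"
          using m q(2) conjunct1[OF kD[OF q(1)]] by simp
      qed
    qed
    show "\<exists>b m. infinite {n. c n = b} \<and>
        (\<forall>q d N. names q d \<longrightarrow> infinite N \<longrightarrow> D q constant_on N \<longrightarrow> (\<forall>x<m. q x = p x) \<longrightarrow>
          (\<forall>x<m. x \<in> N \<longleftrightarrow> x \<in> M) \<longrightarrow> infinite {n. d n = b})"
      if M: "infinite M" "D p constant_on M" for M
    proof -
      obtain a where a: "H (baire_pair p (indicator M)) = Some a" "infinite {n. c n = a 0}"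
        using H[OF p M] by (elim exE conjE)
      have "\<exists>m. \<forall>q s. (\<forall>x<m. q x = baire_pair p (indicator M) x) \<longrightarrow> H q = Some s \<longrightarrow> s 0 = a 0"
        using HK(1) a(1) by (rule computable_baire_continuous[of H "baire_pair p (indicator M)" a 0])
      then obtain m where
        m: "\<forall>q s. (\<forall>x<m. q x = baire_pair p (indicator M) x) \<longrightarrow> H q = Some s \<longrightarrow> s 0 = a 0"
        by (elim exE)
      show ?thesis
      proof (rule exI[of _ "a 0"], rule exI[of _ m], intro conjI allI impI)
        show "infinite {n. c n = a 0}" by (fact a(2))
        fix q d N
        assume q: "names q d" "infinite N" "D q constant_on N" "\<forall>x<m. q x = p x"
          "\<forall>x<m. x \<in> N \<longleftrightarrow> x \<in> M"
        obtain a' where a': "H (baire_pair q (indicator N)) = Some a'" "infinite {n. d n = a' 0}"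
          using H[OF q(1-3)] by (elim exE conjE)
        have "\<forall>x<m. baire_pair q (indicator N) x = baire_pair p (indicator M) x"
        proof (intro allI impI)
          fix x assume "x < m"
          \<comment> \<open>Position \<open>x\<close> of a pair reads position
            \<open>x div 2\<close> of a component, so one bound serves for the name and for the
            set.\<close>
          then have "x div 2 < m" by simp
          with q(4,5) show "baire_pair q (indicator N) x = baire_pair p (indicator M) x"
            by (simp add: baire_pair_def indicator_def)
        qed
        then have "a' 0 = a 0" using m a'(1) by simp
        with a'(2) show "infinite {n. d n = a 0}" by simp
      qed
    qed
  qed
  then show ?thesis by (intro exI)
qed

theorem theorem6p8:
  shows "\<not> jump BWT2 \<le>\<^sub>W jump RT12"
proof
  assume "jump BWT2 \<le>\<^sub>W jump RT12"
  from weihrauch_le_imp_continuous_reduction[OF this] show False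
    by (elim exE) (rule continuous_reduction.no_continuous_reduction)
qed

end
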